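(* There is a randomized algorithm which, given the vertex set $V(G)$ of a graph $G$ (whose edges are unknown), a positive integer $k$, and access to a BISE oracle for $G$, makes $\mathcal{O}(k^4\log k)$ BISE queries and, with probability at least $1-1/k^{c}$ for some constant $c>0$, solves Vertex-Cover: it outputs a vertex cover of $G$ of size at most $k$ if one exists, and otherwise reports that no such vertex cover exists.
   Context: The BISE (bipartite independent set edge) oracle takes as input two disjoint non-empty subsets $A,B\subseteq V(G)$ and returns some edge $(u,v)\in E(G)$ with $u\in A$, $v\in B$ if one exists (an arbitrary such edge), and NULL otherwise. A vertex cover is a set of vertices containing at least one endpoint of every edge. Only oracle queries are counted. *)

theory Defs
  imports "HOL-Probability.Probability" "HOL-Library.Landau_Symbols"
begin

definition simple_graph :: "'a set \<Rightarrow> 'a set set \<Rightarrow> bool" where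
  "simple_graph V E \<longleftrightarrow> finite V \<and> (\<forall>e\<in>E. e \<subseteq> V \<and> card e = 2)"

definition vertex_cover :: "'a set \<Rightarrow> 'a set set \<Rightarrow> 'a set \<Rightarrow> bool" where
  "vertex_cover V E S \<longleftrightarrow> S \<subseteq> V \<and> (\<forall>e\<in>E. S \<inter> e \<noteq> {})"

definition legal_query :: "'a set \<Rightarrow> 'a set \<Rightarrow> 'a set \<Rightarrow> bool" where
  "legal_query V A B \<longleftrightarrow> A \<subseteq> V \<and> B \<subseteq> V \<and> A \<noteq> {} \<and> B \<noteq> {} \<and> A \<inter> B = {}"

type_synonym 'a queries = "('a set \<times> 'a set) list"

text \<open>The answer to a query may depend on the list of queries asked before: which edge is
  returned is arbitrary, and repeating a query need not return the same edge again. An answering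
  function that ignores its first argument is the usual fixed one. Nothing is promised about
  illegal queries.\<close>

type_synonym 'a answering = "'a queries \<Rightarrow> 'a set \<Rightarrow> 'a set \<Rightarrow> ('a \<times> 'a) option"

definition is_BISE :: "'a set \<Rightarrow> 'a set set \<Rightarrow> 'a answering \<Rightarrow> bool" where
  "is_BISE V E ans \<longleftrightarrow>
     (\<forall>h A B. legal_query V A B \<longrightarrow>
        (case ans h A B of
           Some (u, v) \<Rightarrow> u \<in> A \<and> v \<in> B \<and> {u, v} \<in> E
         | None \<Rightarrow> \<not> (\<exists>u\<in>A. \<exists>v\<in>B. {u, v} \<in> E)))"

text \<open>Randomized adaptive query algorithms, as well-founded decision trees: \<open>Query A B f\<close> asks
  \<open>(A, B)\<close> and continues with \<open>f\<close> applied to the answer; \<open>Sample p\<close> continues with an algorithm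
  drawn from \<open>p\<close>, using fresh randomness.\<close>

datatype ('a, 'r) query_alg =
    Return 'r
  | Query "'a set" "'a set" "('a \<times> 'a) option \<Rightarrow> ('a, 'r) query_alg"
  | Sample "('a, 'r) query_alg pmf"

text \<open>The joint distribution of the output and the list of all queries asked, when the queries
  \<open>h\<close> have been asked already.\<close>

primrec run_from :: "'a answering \<Rightarrow> ('a, 'r) query_alg \<Rightarrow> 'a queries \<Rightarrow> ('r \<times> 'a queries) pmf" where
  "run_from ans (Return r) h = return_pmf (r, h)"
| "run_from ans (Query A B f) h = run_from ans (f (ans h A B)) (h @ [(A, B)])"
| "run_from ans (Sample p) h = join_pmf (map_pmf (\<lambda>t. run_from ans t h) p)"

definition run :: "'a answering \<Rightarrow> ('a, 'r) query_alg \<Rightarrow> ('r \<times> 'a queries) pmf" where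
  "run ans t = run_from ans t []"

text \<open>Output \<open>None\<close> is the report that there is no vertex cover of size at most \<open>k\<close>.\<close>

definition solves_VC :: "'a set \<Rightarrow> 'a set set \<Rightarrow> nat \<Rightarrow> 'a set option \<Rightarrow> bool" where
  "solves_VC V E k out \<longleftrightarrow>
     (case out of
        Some S \<Rightarrow> vertex_cover V E S \<and> card S \<le> k
      | None \<Rightarrow> \<not> (\<exists>S. vertex_cover V E S \<and> card S \<le> k))"

end

theory Submission
  imports Defs "HOL-Real_Asymp.Real_Asymp"
begin

text \<open>Keep a set \<open>F\<close> of discovered edges, take any vertex cover \<open>S\<close> of \<open>F\<close> of size at most \<open>k\<close>,
  and query a uniformly random bipartition of \<open>V - S\<close>. A discovered edge avoids \<open>S\<close>, whereas every
  vertex of degree more than \<open>k\<close> in \<open>F\<close> belongs to \<open>S\<close>; so the degrees in \<open>F\<close> never exceed \<open>k + 1\<close>,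
  and once \<open>F\<close> has more than \<open>k (k + 1)\<close> edges it has no cover of size at most \<open>k\<close>. As long as \<open>S\<close>
  does not cover the graph, a step discovers an edge with probability at least \<open>1/2\<close>. If \<open>m\<close>
  discoveries suffice, the failure probability after \<open>n\<close> steps is therefore at most
  \<open>2 ^ m * (3/4) ^ n\<close>, and a number of steps linear in \<open>k\<^sup>2\<close> is enough.\<close>

text \<open>Only queries are counted, so the cover may be chosen non-effectively. The choice depends
  on \<open>V\<close>, \<open>k\<close> and \<open>F\<close> alone: as long as \<open>F\<close>
  stays the same, so does the candidate.\<close>

definition some_solution :: "'a set \<Rightarrow> nat \<Rightarrow> 'a set set \<Rightarrow> 'a set option" where
  "some_solution V k F = (SOME out. solves_VC V F k out)"

text \<open>The third argument counts the remaining steps. A bipartition with an empty side would be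
  an illegal query, so such a step passes without asking anything.\<close>

primrec search :: "'a set \<Rightarrow> nat \<Rightarrow> nat \<Rightarrow> 'a set set \<Rightarrow> ('a, 'a set option) query_alg" where
  "search V k 0 F = Return (some_solution V k F)"
| "search V k (Suc n) F =
     (case some_solution V k F of
        None \<Rightarrow> Return None
      | Some S \<Rightarrow> Sample (map_pmf (\<lambda>A.
          if A = {} \<or> V - S - A = {} then search V k n F
          else Query A (V - S - A) (\<lambda>r. case r of
                 None \<Rightarrow> search V k n F
               | Some (u, v) \<Rightarrow> search V k n (insert {u, v} F)))
          (pmf_of_set (Pow (V - S)))))"

lemma solves_VC_some_solution: "solves_VC V F k (some_solution V k F)"
proof -
  have "\<exists>out. solves_VC V F k out"
  proof (cases "\<exists>S. vertex_cover V F S \<and> card S \<le> k")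
    case True
    then obtain S where "vertex_cover V F S \<and> card S \<le> k" by blast
    then have "solves_VC V F k (Some S)" by (simp add: solves_VC_def)
    then show ?thesis ..
  next
    case False
    then have "solves_VC V F k None" by (simp add: solves_VC_def)
    then show ?thesis ..
  qed
  then show ?thesis
    unfolding some_solution_def by (rule someI_ex)
qed

lemma some_solution_SomeD:
  assumes "some_solution V k F = Some S"
  shows "vertex_cover V F S" "card S \<le> k"
  using solves_VC_some_solution[of V F k] assms by (simp_all add: solves_VC_def)

text \<open>A cover of \<open>E\<close> also covers \<open>F\<close>. Hence a report
  \<open>None\<close> based on discovered edges alone is never wrong.\<close>

lemma solves_VC_None_mono:
  assumes "solves_VC V F k None" "F \<subseteq> E"
  shows "solves_VC V E k None"
  using assms unfolding solves_VC_def vertex_cover_def option.case by (meson subsetD)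

section \<open>Runs of the search: legality and number of queries, stability of a correct
  candidate\<close>

lemma run_from_Sample_map:
  "run_from ans (Sample (map_pmf f p)) h = bind_pmf p (\<lambda>x. run_from ans (f x) h)"
  by (simp add: bind_eq_join_pmf pmf.map_comp o_def)

lemma search_queries:
  assumes "finite V"
    and "(out, qs) \<in> set_pmf (run_from ans (search V k n F) h)"
    and "\<forall>(A, B)\<in>set h. legal_query V A B"
  shows "(\<forall>(A, B)\<in>set qs. legal_query V A B) \<and> length qs \<le> length h + n"
  using assms(2,3)
proof (induction n arbitrary: F h)
  case 0
  then show ?case by simp
next
  case (Suc n)
  show ?case
  proof (cases "some_solution V k F")
    case None
    then show ?thesis using Suc.prems by simp
  next
    case (Some S)
    have fin: "finite (Pow (V - S))" "Pow (V - S) \<noteq> {}"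
      using assms(1) by auto
    obtain A where A: "A \<subseteq> V - S"
      and out: "(out, qs) \<in> set_pmf (run_from ans
          (if A = {} \<or> V - S - A = {} then search V k n F
           else Query A (V - S - A) (\<lambda>r. case r of
                 None \<Rightarrow> search V k n F
               | Some (u, v) \<Rightarrow> search V k n (insert {u, v} F))) h)"
      using Suc.prems(1) fin Some unfolding search.simps
      by (simp add: run_from_Sample_map del: run_from.simps) blast
    show ?thesis
    proof (cases "A = {} \<or> V - S - A = {}")
      case True
      then show ?thesis using Suc.IH[of F h] Suc.prems(2) out by auto
    next
      case False
      let ?B = "V - S - A"
      obtain F' where "(out, qs) \<in> set_pmf (run_from ans (search V k n F') (h @ [(A, ?B)]))"
        using out False by (auto split: option.splits prod.splits)
      moreover have "legal_query V A ?B"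
        using False A by (auto simp: legal_query_def)
      ultimately show ?thesis
        using Suc.IH[of F' "h @ [(A, ?B)]"] Suc.prems(2) by auto
    qed
  qed
qed

text \<open>Every query lies inside \<open>V - S\<close>, which contains no edge once
  \<open>S\<close> covers the graph. All answers are then \<open>None\<close>, so \<open>F\<close>
  and with it the candidate never change.\<close>

lemma search_correct_if_covers:
  assumes G: "simple_graph V E" and bise: "is_BISE V E ans"
    and S: "some_solution V k F = Some S" and cover: "vertex_cover V E S"
    and out: "(out, qs) \<in> set_pmf (run_from ans (search V k n F) h)"
  shows "out = Some S"
  using out
proof (induction n arbitrary: h)
  case 0
  then show ?case using S by simp
next
  case (Suc n)
  have fin: "finite (Pow (V - S))" "Pow (V - S) \<noteq> {}"
    using G by (auto simp: simple_graph_def)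
  obtain A where A: "A \<subseteq> V - S"
    and out: "(out, qs) \<in> set_pmf (run_from ans
        (if A = {} \<or> V - S - A = {} then search V k n F
         else Query A (V - S - A) (\<lambda>r. case r of
               None \<Rightarrow> search V k n F
             | Some (u, v) \<Rightarrow> search V k n (insert {u, v} F))) h)"
    using Suc.prems(1) fin S unfolding search.simps
    by (simp add: run_from_Sample_map del: run_from.simps) blast
  show ?case
  proof (cases "A = {} \<or> V - S - A = {}")
    case True
    then show ?thesis using Suc.IH[of h] out by auto
  next
    case False
    have "legal_query V A (V - S - A)"
      using False A by (auto simp: legal_query_def)
    then have "case ans h A (V - S - A) of
        Some (u, v) \<Rightarrow> u \<in> A \<and> v \<in> V - S - A \<and> {u, v} \<in> E | None \<Rightarrow> True"
      using bise unfolding is_BISE_def by (fastforce split: option.splits)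
    moreover have "{u, v} \<notin> E" if "u \<in> A" "v \<in> V - S - A" for u v
      using cover that A by (auto simp: vertex_cover_def)
    ultimately have "ans h A (V - S - A) = None"
      by (auto split: option.splits)
    then show ?thesis using Suc.IH out False by auto
  qed
qed

section \<open>Degree bounds for the discovered edges\<close>

text \<open>\<open>F\<close> is the union of the stars at the vertices of \<open>S\<close>.\<close>

lemma card_le_of_degree_le:
  assumes "vertex_cover V F S" "card S \<le> k" "finite S" "finite F"
    and "\<And>v. card {e\<in>F. v \<in> e} \<le> d"
  shows "card F \<le> k * d"
proof -
  have "F = (\<Union>v\<in>S. {e\<in>F. v \<in> e})"
    using assms(1) by (auto simp: vertex_cover_def)
  then have "card F \<le> (\<Sum>v\<in>S. card {e\<in>F. v \<in> e})"
    using card_UN_le[OF assms(3), of "\<lambda>v. {e\<in>F. v \<in> e}"] by simp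
  also have "\<dots> \<le> (\<Sum>v\<in>S. d)"
    by (intro sum_mono assms(5))
  also have "\<dots> \<le> k * d" using assms(2) by simp
  finally show ?thesis .
qed

text \<open>The other end of each edge at \<open>u\<close> must lie in \<open>S\<close> and
  determines the edge.\<close>

lemma degree_le_of_notin_cover:
  assumes "vertex_cover V F S" "finite S" "\<And>e. e \<in> F \<Longrightarrow> card e = 2" "u \<notin> S"
  shows "card {e\<in>F. u \<in> e} \<le> card S"
proof -
  have "{e\<in>F. u \<in> e} \<subseteq> (\<lambda>w. {u, w}) ` S"
  proof
    fix e assume "e \<in> {e\<in>F. u \<in> e}"
    then have e: "e \<in> F" "u \<in> e" by auto
    obtain w where w: "w \<in> S" "w \<in> e"
      using assms(1) e by (auto simp: vertex_cover_def)
    moreover have "e = {u, w}"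
      using assms(3)[OF e(1)] e(2) w assms(4) by (auto simp: card_2_iff)
    ultimately show "e \<in> (\<lambda>w. {u, w}) ` S" by blast
  qed
  then have "card {e\<in>F. u \<in> e} \<le> card ((\<lambda>w. {u, w}) ` S)"
    using assms(2) by (intro card_mono) auto
  also have "\<dots> \<le> card S" using assms(2) by (rule card_image_le)
  finally show ?thesis .
qed

section \<open>Averaging over random bipartitions\<close>

text \<open>Toggling \<open>u\<close> is an involution on the subsets of \<open>W\<close>. Of
  \<open>A\<close> and its image exactly one separates \<open>u\<close> from \<open>v\<close>, so
  their values sum to at most \<open>c + c / 2\<close>.\<close>

lemma sum_Pow_le_of_split:
  fixes f :: "'a set \<Rightarrow> real"
  assumes "finite W" "u \<in> W" "u \<noteq> v"
    and le: "\<And>A. A \<subseteq> W \<Longrightarrow> f A \<le> c"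
    and split: "\<And>A. A \<subseteq> W \<Longrightarrow> (u \<in> A \<longleftrightarrow> v \<notin> A) \<Longrightarrow> f A \<le> c / 2"
  shows "sum f (Pow W) \<le> 3 / 4 * c * card (Pow W)"
proof -
  define t where "t A = (if u \<in> A then A - {u} else insert u A)" for A
  have "bij_betw t (Pow W) (Pow W)"
    by (rule bij_betw_byWitness[where f' = t]) (use assms(2) in \<open>auto simp: t_def\<close>)
  then have "sum f (Pow W) = (\<Sum>A\<in>Pow W. f (t A))"
    by (rule sum.reindex_bij_betw[symmetric])
  then have "2 * sum f (Pow W) = (\<Sum>A\<in>Pow W. f A + f (t A))"
    by (simp add: sum.distrib)
  also have "\<dots> \<le> (\<Sum>A\<in>Pow W. 3 / 2 * c)"
  proof (rule sum_mono)
    fix A assume "A \<in> Pow W"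
    then have A: "A \<subseteq> W" "t A \<subseteq> W" using assms(2) by (auto simp: t_def)
    have "(u \<in> A \<longleftrightarrow> v \<notin> A) \<or> (u \<in> t A \<longleftrightarrow> v \<notin> t A)"
      using assms(3) by (auto simp: t_def)
    then show "f A + f (t A) \<le> 3 / 2 * c"
      using le[OF A(1)] le[OF A(2)] split[OF A(1)] split[OF A(2)] by auto
  qed
  finally show ?thesis by (simp add: mult_ac)
qed

lemma prob_bind_pmf_of_set:
  assumes "finite W" "W \<noteq> {}"
  shows "measure_pmf.prob (bind_pmf (pmf_of_set W) g) X
      = (\<Sum>x\<in>W. measure_pmf.prob (g x) X) / card W"
proof -
  have "ennreal (measure_pmf.prob (bind_pmf (pmf_of_set W) g) X)
      = (\<Sum>x\<in>W. ennreal (measure_pmf.prob (g x) X)) / card W"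
    using assms unfolding measure_pmf.emeasure_eq_measure[symmetric]
    by (simp add: nn_integral_pmf_of_set)
  also have "\<dots> = ennreal ((\<Sum>x\<in>W. measure_pmf.prob (g x) X) / card W)"
    using assms by (simp add: sum_nonneg divide_ennreal[symmetric] card_gt_0_iff
        ennreal_of_nat_eq_real_of_nat)
  finally show ?thesis
    by (subst (asm) ennreal_inj) (auto intro!: sum_nonneg divide_nonneg_nonneg)
qed

section \<open>Failure probability\<close>

definition search_invariant :: "'a set set \<Rightarrow> nat \<Rightarrow> 'a set set \<Rightarrow> bool" where
  "search_invariant E k F \<longleftrightarrow> F \<subseteq> E \<and> (\<forall>v. card {e\<in>F. v \<in> e} \<le> k + 1)"

text \<open>Here \<open>m\<close> is the number of discoveries left until \<open>F\<close> is too
  large to have a cover of size \<open>k\<close>. A discovery halves the bound, and averaging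
  \<open>1\<close> and \<open>1 / 2\<close> gives the factor \<open>3 / 4\<close> per step. The
  history \<open>h\<close> is arbitrary because the answers may depend on it.\<close>

lemma search_failure:
  assumes G: "simple_graph V E" and bise: "is_BISE V E ans"
    and "search_invariant E k F"
    and "card F + m = k * (k + 1) + 1"
  shows "measure_pmf.prob (run_from ans (search V k n F) h) {(out, qs). \<not> solves_VC V E k out}
      \<le> 2 ^ m * (3 / 4) ^ n"
  using assms(3,4)
proof (induction n arbitrary: F h m)
  case 0
  have "measure_pmf.prob p X \<le> 2 ^ m" for p :: "('a set option \<times> 'a queries) pmf" and X
    by (rule order_trans[OF measure_pmf.prob_le_1]) simp
  from this[of "run_from ans (search V k 0 F) h"] show ?case
    by (simp del: search.simps)
next
  case (Suc n)
  let ?bad = "{(out, qs :: 'a queries). \<not> solves_VC V E k out}"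
  have finV: "finite V" and edge: "\<And>e. e \<in> E \<Longrightarrow> e \<subseteq> V \<and> card e = 2"
    using G by (auto simp: simple_graph_def)
  have "E \<subseteq> Pow V" using edge by auto
  then have finE: "finite E" using finV by (meson finite_Pow_iff finite_subset)
  have FE: "F \<subseteq> E" and deg: "\<And>v. card {e\<in>F. v \<in> e} \<le> k + 1"
    using Suc.prems(1) by (auto simp: search_invariant_def)
  have finF: "finite F" using FE finE by (rule finite_subset)
  show ?case
  proof (cases "some_solution V k F")
    case None
    then have "solves_VC V E k None"
      using solves_VC_None_mono[OF _ FE] solves_VC_some_solution[of V F k] by metis
    then show ?thesis using None by simp
  next
    case (Some S)
    note S = some_solution_SomeD[OF Some]
    have finS: "finite S" using S(1) finV by (auto simp: vertex_cover_def intro: finite_subset)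
    \<comment> \<open>A candidate still exists, so \<open>F\<close> is below the threshold and
      \<open>m\<close> is positive.\<close>
    have "card F \<le> k * (k + 1)"
      by (rule card_le_of_degree_le[OF S finS finF deg])
    then obtain m' where m': "m = Suc m'" using Suc.prems(2) by (cases m) auto
    show ?thesis
    proof (cases "vertex_cover V E S")
      case True
      have "out = Some S" if "(out, qs) \<in> set_pmf (run_from ans (search V k (Suc n) F) h)" for out qs
        using search_correct_if_covers[OF G bise Some True that] .
      moreover have "solves_VC V E k (Some S)" using True S(2) by (simp add: solves_VC_def)
      ultimately have "set_pmf (run_from ans (search V k (Suc n) F) h) \<inter> ?bad = {}" by blast
      then have "measure_pmf.prob (run_from ans (search V k (Suc n) F) h) ?bad = 0"
        by (simp only: measure_pmf_zero_iff)
      then show ?thesis by (simp del: search.simps)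
    next
      case False
      define W where "W = V - S"
      have finW: "finite W" using finV by (simp add: W_def)
      \<comment> \<open>An uncovered edge: any bipartition that separates its ends forces a
        discovery.\<close>
      obtain e where e: "e \<in> E" "S \<inter> e = {}"
        using False S(1) by (auto simp: vertex_cover_def)
      obtain u v where uv: "e = {u, v}" "u \<noteq> v"
        using edge[OF e(1)] by (auto simp: card_2_iff)
      have uvW: "u \<in> W" "v \<in> W" using e uv edge[OF e(1)] by (auto simp: W_def)
      define cont where "cont A =
          (if A = {} \<or> W - A = {} then search V k n F
           else Query A (W - A) (\<lambda>r. case r of
                 None \<Rightarrow> search V k n F
               | Some (u, v) \<Rightarrow> search V k n (insert {u, v} F)))" for A
      define f where "f A = measure_pmf.prob (run_from ans (cont A) h) ?bad" for A
      define c :: real where "c = 2 ^ m * (3 / 4) ^ n"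
      have stay: "measure_pmf.prob (run_from ans (search V k n F) h') ?bad \<le> c" for h'
        using Suc.IH[OF Suc.prems] by (simp add: c_def)
      have found: "measure_pmf.prob (run_from ans (search V k n (insert {a, b} F)) h') ?bad \<le> c / 2"
        if ab: "a \<in> W" "b \<in> W" "{a, b} \<in> E" for a b h'
      proof -
        have new: "{a, b} \<notin> F"
          using S(1) ab by (auto simp: vertex_cover_def W_def)
        \<comment> \<open>Both ends of the new edge lie outside \<open>S\<close>, so their degree
          was at most \<open>k\<close> before and is at most \<open>k + 1\<close> now.\<close>
        have "card {e\<in>insert {a, b} F. w \<in> e} \<le> k + 1" for w
        proof (cases "w \<in> {a, b}")
          case True
          have "card {e\<in>F. w \<in> e} \<le> card S"
            by (rule degree_le_of_notin_cover[OF S(1) finS])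
              (use FE edge True ab in \<open>auto simp: W_def\<close>)
          moreover have "{e\<in>insert {a, b} F. w \<in> e} = insert {a, b} {e\<in>F. w \<in> e}"
            using True by auto
          moreover have "card (insert {a, b} {e\<in>F. w \<in> e}) \<le> Suc (card {e\<in>F. w \<in> e})"
            by (rule card_insert_le_m1) simp_all
          ultimately show ?thesis using S(2) by simp
        next
          case False
          then have "{e\<in>insert {a, b} F. w \<in> e} = {e\<in>F. w \<in> e}" by auto
          then show ?thesis using deg by simp
        qed
        then have "search_invariant E k (insert {a, b} F)"
          using FE ab by (auto simp: search_invariant_def)
        moreover have "card (insert {a, b} F) + m' = k * (k + 1) + 1"
          using new finF Suc.prems(2) m' by simp
        ultimately have "measure_pmf.prob (run_from ans (search V k n (insert {a, b} F)) h') ?bad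
            \<le> 2 ^ m' * (3 / 4) ^ n"
          by (rule Suc.IH)
        then show ?thesis by (simp add: c_def m')
      qed
      have c: "c / 2 \<le> c" by (simp add: c_def)
      have "f A \<le> c \<and> ((u \<in> A \<longleftrightarrow> v \<notin> A) \<longrightarrow> f A \<le> c / 2)" if A: "A \<subseteq> W" for A
      proof (cases "A = {} \<or> W - A = {}")
        case True
        \<comment> \<open>With an empty side, \<open>u\<close> and \<open>v\<close> are on the same
          side, and only the weaker bound is required.\<close>
        then have "\<not> (u \<in> A \<longleftrightarrow> v \<notin> A)" using uvW by auto
        then show ?thesis using stay True by (simp add: f_def cont_def)
      next
        case False
        have "legal_query V A (W - A)"
          using False A by (auto simp: legal_query_def W_def)
        then have ans: "case ans h A (W - A) of
           Some (u, v) \<Rightarrow> u \<in> A \<and> v \<in> W - A \<and> {u, v} \<in> E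
         | None \<Rightarrow> \<not> (\<exists>u\<in>A. \<exists>v\<in>W - A. {u, v} \<in> E)"
          using bise unfolding is_BISE_def by blast
        show ?thesis
        proof (cases "ans h A (W - A)")
          case None
          have "{u, v} \<in> E" "{v, u} \<in> E" using e uv by (auto simp: insert_commute)
          then have "\<not> (u \<in> A \<longleftrightarrow> v \<notin> A)" using ans None uvW by auto
          then show ?thesis using stay None False by (simp add: f_def cont_def)
        next
          case (Some r)
          obtain a b where "r = (a, b)" by (cases r)
          with Some ans A have ab: "a \<in> W" "b \<in> W" "{a, b} \<in> E" "ans h A (W - A) = Some (a, b)"
            by auto
          \<comment> \<open>The returned edge need not be \<open>{u, v}\<close>: every edge inside
            \<open>W\<close> is new and makes the same progress.\<close>
          have "f A \<le> c / 2"
            using found[OF ab(1-3)] ab(4) False by (simp add: f_def cont_def)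
          then show ?thesis using c by simp
        qed
      qed
      then have sum: "sum f (Pow W) \<le> 3 / 4 * c * card (Pow W)"
        by (intro sum_Pow_le_of_split[OF finW uvW(1) uv(2)]) auto
      have "search V k (Suc n) F = Sample (map_pmf cont (pmf_of_set (Pow W)))"
        unfolding search.simps Some option.case cont_def W_def ..
      then have "measure_pmf.prob (run_from ans (search V k (Suc n) F) h) ?bad
          = sum f (Pow W) / card (Pow W)"
        using finW by (simp only: run_from_Sample_map)
          (subst prob_bind_pmf_of_set, auto simp: f_def)
      also have "\<dots> \<le> 3 / 4 * c"
      proof (rule divide_le_eq[THEN iffD2])
        have "card (Pow W) > 0" using finW by (simp add: card_Pow)
        then show "if 0 < real (card (Pow W)) then sum f (Pow W) \<le> 3 / 4 * c * real (card (Pow W))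
          else if real (card (Pow W)) < 0 then 3 / 4 * c * real (card (Pow W)) \<le> sum f (Pow W)
          else 0 \<le> 3 / 4 * c"
          using sum by simp
      qed
      finally show ?thesis by (simp add: c_def)
    qed
  qed
qed

theorem theorem2:
  "\<exists>(alg :: 'a set \<Rightarrow> nat \<Rightarrow> ('a, 'a set option) query_alg) (q :: nat \<Rightarrow> nat) (c :: real).
     c > 0 \<and>
     (\<lambda>k. real (q k)) \<in> O(\<lambda>k. real k ^ 4 * ln (real k)) \<and>
     (\<forall>V E k ans. simple_graph V E \<longrightarrow> k \<ge> 1 \<longrightarrow> is_BISE V E ans \<longrightarrow>
        (\<forall>(out, qs) \<in> set_pmf (run ans (alg V k)).
           (\<forall>(A, B) \<in> set qs. legal_query V A B) \<and> length qs \<le> q k) \<and>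
        measure_pmf.prob (run ans (alg V k)) {(out, qs). solves_VC V E k out}
          \<ge> 1 - 1 / real k powr c)"
proof -
  \<comment> \<open>One more than the largest number of discovered edges that still admits a
    candidate.\<close>
  define m :: "nat \<Rightarrow> nat" where "m k = k * (k + 1) + 1" for k
  define alg :: "'a set \<Rightarrow> nat \<Rightarrow> ('a, 'a set option) query_alg"
    where "alg V k = search V k (5 * m k) {}" for V k
  \<comment> \<open>The query bound is quadratic in \<open>k\<close>, well inside the required
    class.\<close>
  have "(\<lambda>k. real (5 * m k)) \<in> O(\<lambda>k. real k ^ 4 * ln (real k))"
    unfolding m_def of_nat_mult of_nat_add by real_asymp
  moreover have "(\<forall>(out, qs) \<in> set_pmf (run ans (alg V k)).
           (\<forall>(A, B) \<in> set qs. legal_query V A B) \<and> length qs \<le> 5 * m k)"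
    if "simple_graph V E" for V E k ans
  proof -
    have "finite V" using that by (simp add: simple_graph_def)
    from search_queries[OF this, where h = "[]"] show ?thesis
      by (fastforce simp: run_def alg_def)
  qed
  moreover have "measure_pmf.prob (run ans (alg V k)) {(out, qs). solves_VC V E k out}
      \<ge> 1 - 1 / real k powr 1"
    if G: "simple_graph V E" and k: "k \<ge> 1" and bise: "is_BISE V E ans" for V E k ans
  proof -
    have "measure_pmf.prob (run ans (alg V k)) {(out, qs). \<not> solves_VC V E k out}
        \<le> 2 ^ m k * (3 / 4) ^ (5 * m k)"
      unfolding run_def alg_def
      by (rule search_failure[OF G bise]) (auto simp: search_invariant_def m_def)
    also have "\<dots> = (2 * (3 / 4) ^ 5) ^ m k"
      by (simp add: power_mult power_mult_distrib)
    \<comment> \<open>The reason for five steps per unit of \<open>m k\<close>: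
      \<open>2 * (3 / 4) ^ 5 = 486 / 1024\<close>, just below \<open>1 / 2\<close>.\<close>
    also have "\<dots> \<le> (1 / 2 :: real) ^ m k"
      by (rule power_mono) (simp_all add: power_divide)
    also have "\<dots> = 1 / 2 ^ m k" by (simp add: power_divide)
    also have "\<dots> \<le> 1 / real k"
    proof -
      have "k \<le> m k" by (simp add: m_def)
      also have "m k < 2 ^ m k" by (rule less_exp)
      finally have "real k \<le> 2 ^ m k" by (metis less_imp_le of_nat_le_iff of_nat_numeral of_nat_power)
      then show ?thesis using k by (intro divide_left_mono) auto
    qed
    finally have "measure_pmf.prob (run ans (alg V k)) {(out, qs). \<not> solves_VC V E k out}
        \<le> 1 / real k" .
    moreover have "{(out, qs). \<not> solves_VC V E k out}
        = space (measure_pmf (run ans (alg V k))) - {(out, qs). solves_VC V E k out}"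
      by auto
    ultimately show ?thesis
      using k measure_pmf.prob_compl[of "{(out, qs). solves_VC V E k out}" "run ans (alg V k)"]
      by simp
  qed
  ultimately show ?thesis
    by (intro exI[of _ alg] exI[of _ "\<lambda>k. 5 * m k"] exI[of _ 1]) auto
qed

end
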